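(* Let $p$ be a prime, $q=p^l$, $n\ge 2$ and $k\ge1$ integers, and $d=\gcd(k,q-1)$. If $\gcd\big((q-1)/d,\,p-1\big)\ge 3$ (equivalently, the cyclic group $\mathbb F_p^\times\cap\{x^d\mid x\in\mathbb F_q\}$ has at least 3 elements) and $n>p-1$, then every cyclic matrix $A\in M_n(\mathbb F_q)$ with $\operatorname{Tr}(A)\in\mathbb F_p$ is of the form $B^k+C^k$ with $B,C\in M_n(\mathbb F_q)$.
   Context: A matrix $A\in M_n(K)$ is cyclic if its minimal polynomial equals its characteristic polynomial. *)

theory Defs
  imports
    "Jordan_Normal_Form.Char_Poly"
    "HOL-Computational_Algebra.Primes"
    "HOL-Library.Cardinality"
begin

definition mat_trace :: "'a :: comm_monoid_add mat \<Rightarrow> 'a" where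
  "mat_trace A = (\<Sum>i<dim_row A. A $$ (i, i))"

text \<open>The value \<open>f(A)\<close> of a polynomial at a square matrix. The sum of the matrices
  \<open>coeff f k \<cdot>\<^sub>m A ^\<^sub>m k\<close> is written entrywise because matrices of varying dimension do not
  form an additive monoid type.\<close>

definition poly_mat :: "'a :: comm_ring_1 poly \<Rightarrow> 'a mat \<Rightarrow> 'a mat" where
  "poly_mat f A = mat (dim_row A) (dim_row A)
     (\<lambda>ij. \<Sum>k\<le>degree f. (coeff f k \<cdot>\<^sub>m (A ^\<^sub>m k)) $$ ij)"

definition is_min_poly :: "'a :: field mat \<Rightarrow> 'a poly \<Rightarrow> bool" where
  "is_min_poly A m \<longleftrightarrow>
     lead_coeff m = 1 \<and> poly_mat m A = 0\<^sub>m (dim_row A) (dim_row A) \<and>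
     (\<forall>f. f \<noteq> 0 \<and> poly_mat f A = 0\<^sub>m (dim_row A) (dim_row A) \<longrightarrow> degree m \<le> degree f)"

definition cyclic_mat :: "'a :: field mat \<Rightarrow> bool" where
  "cyclic_mat A \<longleftrightarrow> square_mat A \<and> is_min_poly A (char_poly A)"

text \<open>In a field of characteristic \<open>p > 0\<close> the image of the integers is the prime subfield,
  a copy of the field with \<open>p\<close> elements.\<close>

definition prime_subfield :: "'a :: field set" where
  "prime_subfield = range of_int"

lemma poly_mat_index:
  assumes "square_mat A" "i < dim_row A" "j < dim_row A" "degree f \<le> N"
  shows "poly_mat f A $$ (i, j) = (\<Sum>k\<le>N. coeff f k * (A ^\<^sub>m k) $$ (i, j))"
proof -
  have A: "A \<in> carrier_mat (dim_row A) (dim_row A)"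
    using assms(1) by (metis carrier_matI square_mat.simps)
  have pow: "A ^\<^sub>m k \<in> carrier_mat (dim_row A) (dim_row A)" for k
    using pow_carrier_mat[OF A] .
  have "poly_mat f A $$ (i, j) = (\<Sum>k\<le>degree f. coeff f k * (A ^\<^sub>m k) $$ (i, j))"
    using assms(2,3) carrier_matD[OF pow] by (simp add: poly_mat_def)
  also have "\<dots> = (\<Sum>k\<le>N. coeff f k * (A ^\<^sub>m k) $$ (i, j))"
    by (rule sum.mono_neutral_left) (use assms(4) in \<open>auto simp: coeff_eq_0\<close>)
  finally show ?thesis .
qed

lemma is_min_poly_unique:
  assumes sq: "square_mat A" and m: "is_min_poly A m" and m': "is_min_poly A m'"
  shows "m = m'"
proof (rule ccontr)
  assume ne: "m \<noteq> m'"
  have z: "poly_mat m A = 0\<^sub>m (dim_row A) (dim_row A)"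
    and z': "poly_mat m' A = 0\<^sub>m (dim_row A) (dim_row A)"
    using m m' by (auto simp: is_min_poly_def)
  have nz: "m \<noteq> 0" "m' \<noteq> 0" using m m' by (auto simp: is_min_poly_def)
  have deg: "degree m' = degree m"
    using m m' nz unfolding is_min_poly_def by (meson order_antisym)
  have dle: "degree (m - m') \<le> degree m" by (rule degree_diff_le) (simp_all add: deg)
  have "poly_mat (m - m') A = 0\<^sub>m (dim_row A) (dim_row A)"
  proof (rule eq_matI)
    fix i j assume "i < dim_row (0\<^sub>m (dim_row A) (dim_row A) :: 'a mat)"
      and "j < dim_col (0\<^sub>m (dim_row A) (dim_row A) :: 'a mat)"
    then have ij: "i < dim_row A" "j < dim_row A" by auto
    have "poly_mat (m - m') A $$ (i, j) = poly_mat m A $$ (i, j) - poly_mat m' A $$ (i, j)"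
      using dle deg
      by (simp add: poly_mat_index[OF sq ij, of _ "degree m"] left_diff_distrib sum_subtractf)
    then show "poly_mat (m - m') A $$ (i, j) = 0\<^sub>m (dim_row A) (dim_row A) $$ (i, j)"
      using z z' ij by simp
  qed (auto simp: poly_mat_def)
  then have "degree m \<le> degree (m - m')" using m ne unfolding is_min_poly_def by auto
  then have eq: "degree (m - m') = degree m" using dle by simp
  have "coeff (m - m') (degree m) = 0"
    using m m' deg by (simp add: is_min_poly_def)
  then have "m - m' = 0" using eq by (metis leading_coeff_0_iff)
  then show False using ne by simp
qed

end

theory Submission
  imports Defs "HOL-Number_Theory.Cong"
begin

text \<open>
  In a basis of the form \<open>\<Prod>j<i. (A - a\<^sub>j)\<close> applied to a cyclic vector, \<open>A\<close> becomes a matrix with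
  freely prescribed diagonal entries \<open>a\<^sub>0, \<dots>, a\<^sub>n\<^sub>-\<^sub>2\<close>, ones below the diagonal, an arbitrary last column,
  and zeros elsewhere; the last diagonal entry is then forced by the trace. The hypothesis provides
  three distinct \<open>k\<close>-th powers \<open>x, y, z\<close> in the multiplicative group of the prime field. Take
  \<open>a\<^sub>i = x + w\<^sub>i\<close> with \<open>w\<^sub>i \<in> {y, z}\<close>; as \<open>n \<ge> p\<close>, the number of \<open>z\<close>'s can be chosen such that the last
  diagonal entry is \<open>w\<^sub>n\<^sub>-\<^sub>1\<close>. Distributing the subdiagonal ones alternately over two summands gives block
  diagonal matrices with blocks of size at most two having the distinct eigenvalues \<open>x\<close> and \<open>w\<^sub>i\<close>,
  and these are explicit \<open>k\<close>-th powers. The summand that has \<open>0\<close> as its last row also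
  absorbs the last column.
\<close>

section \<open>Comaximal polynomials\<close>

text \<open>Coprimality in the form of a Bezout identity. Such identities can be multiplied, so the
  arguments below run without gcds or unique factorization.\<close>

definition comaximal :: "'a :: comm_ring_1 \<Rightarrow> 'a \<Rightarrow> bool" where
  "comaximal f g \<longleftrightarrow> (\<exists>a b. a * f + b * g = 1)"

lemma comaximal_sym: "comaximal f g \<Longrightarrow> comaximal g f"
  unfolding comaximal_def by (metis add.commute)

lemma comaximal_mult_right:
  assumes "comaximal f g" "comaximal f h"
  shows "comaximal f (g * h)"
proof -
  obtain a b c d where "a * f + b * g = 1" "c * f + d * h = 1"
    using assms unfolding comaximal_def by blast
  then have "(a * f + b * g) * (c * f + d * h) = 1" by simp
  then have "(a * c * f + a * d * h + b * g * c) * f + (b * d) * (g * h) = 1"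
    by (simp add: algebra_simps)
  then show ?thesis unfolding comaximal_def by blast
qed

lemma comaximal_power_right: "comaximal f g \<Longrightarrow> comaximal f (g ^ m)"
proof (induction m)
  case 0
  show ?case unfolding comaximal_def by (rule exI[of _ 0], rule exI[of _ 1]) simp
qed (simp add: comaximal_mult_right)

lemma comaximal_power_left: "comaximal f g \<Longrightarrow> comaximal (f ^ m) g"
  by (simp add: comaximal_sym comaximal_power_right)

lemma comaximal_dvd_mult:
  assumes "comaximal f g" "f dvd g * h"
  shows "f dvd h"
proof -
  obtain a b where "a * f + b * g = 1" using assms unfolding comaximal_def by blast
  then have "h = (a * f + b * g) * h" by simp
  then have "h = f * (a * h) + b * (g * h)" by (simp add: algebra_simps)
  then show ?thesis using assms(2) by (metis dvd_add dvd_mult dvd_triv_left)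
qed

lemma comaximal_mult_dvd:
  assumes "comaximal f g" "f dvd h" "g dvd h"
  shows "f * g dvd h"
proof -
  obtain h' where h': "h = g * h'" using assms(3) by blast
  then have "f dvd h'" using comaximal_dvd_mult assms by blast
  then show ?thesis unfolding h' by (metis mult.commute mult_dvd_mono dvd_refl)
qed

text \<open>Division with remainder: \<open>h mod m\<close> stays in \<open>I\<close>, so a nonzero
  remainder would contradict the minimality of \<open>degree m\<close>. It serves both for ideals
  spanned by two polynomials and for annihilators of vectors.\<close>

lemma poly_ideal_dvd:
  fixes m :: "'a :: field poly"
  assumes add: "\<And>f g. f \<in> I \<Longrightarrow> g \<in> I \<Longrightarrow> f + g \<in> I" and mult: "\<And>r f. f \<in> I \<Longrightarrow> r * f \<in> I"
    and m: "m \<in> I" "m \<noteq> 0" and min: "\<And>f. f \<in> I \<Longrightarrow> f \<noteq> 0 \<Longrightarrow> degree m \<le> degree f"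
    and h: "h \<in> I"
  shows "m dvd h"
proof (rule ccontr)
  assume nd: "\<not> m dvd h"
  have "h mod m = h + (- (h div m)) * m" by (simp add: minus_div_mult_eq_mod[symmetric])
  then have "h mod m \<in> I" using add mult m h by metis
  moreover have ne: "h mod m \<noteq> 0" using nd by (simp add: mod_eq_0_iff_dvd)
  ultimately have "degree m \<le> degree (h mod m)" using min by blast
  then show False using degree_mod_less'[OF m(2) ne] by simp
qed

section \<open>Irreducible polynomials and their powers\<close>

definition irreducible_factor :: "'a :: field poly \<Rightarrow> bool" where
  "irreducible_factor \<pi> \<longleftrightarrow> degree \<pi> > 0 \<and> (\<forall>h. h dvd \<pi> \<longrightarrow> degree h = 0 \<or> degree h = degree \<pi>)"

lemma exists_irreducible_factor:
  fixes f :: "'a :: field poly"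
  assumes "degree f > 0"
  obtains \<pi> where "irreducible_factor \<pi>" "\<pi> dvd f"
proof -
  define P where "P = (\<lambda>h. h dvd f \<and> degree h > 0)"
  have Pf: "P f" using assms by (simp add: P_def)
  define \<pi> where "\<pi> = arg_min degree P"
  have 1: "P \<pi>" and 2: "\<And>h. P h \<Longrightarrow> degree \<pi> \<le> degree h"
    unfolding \<pi>_def using arg_min_nat_lemma[of P f degree, OF Pf] by auto
  have "degree h = 0 \<or> degree h = degree \<pi>" if "h dvd \<pi>" for h
  proof -
    have "h dvd f" "degree h \<le> degree \<pi>"
      using that 1 unfolding P_def by (auto intro: dvd_trans dvd_imp_degree_le)
    then show ?thesis using 2[of h] unfolding P_def by fastforce
  qed
  then have "irreducible_factor \<pi>" using 1 unfolding irreducible_factor_def P_def by blast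
  then show ?thesis using that 1 unfolding P_def by blast
qed

lemma degree_0_dvd:
  fixes f :: "'a :: field poly"
  assumes "f \<noteq> 0" "degree f = 0"
  shows "f dvd g"
  using assms by (meson is_unit_iff_degree unit_imp_dvd)

text \<open>A generator of the ideal spanned by \<open>\<pi>\<close> and \<open>g\<close> divides
  \<open>\<pi>\<close>, so it is constant or has full degree. In the second case it is associated to
  \<open>\<pi>\<close>, which would then divide \<open>g\<close>.\<close>

lemma irreducible_factor_comaximal:
  fixes \<pi> :: "'a :: field poly"
  assumes "irreducible_factor \<pi>" "\<not> \<pi> dvd g"
  shows "comaximal \<pi> g"
proof -
  define I where "I = {a * \<pi> + b * g | a b. True}"
  have "\<pi> = 1 * \<pi> + 0 * g" "g = 0 * \<pi> + 1 * g" by simp_all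
  then have mem: "\<pi> \<in> I" "g \<in> I" unfolding I_def by blast+
  have nz: "\<pi> \<noteq> 0" using assms unfolding irreducible_factor_def by auto
  define m where "m = arg_min degree (\<lambda>h. h \<in> I \<and> h \<noteq> 0)"
  have 1: "m \<in> I \<and> m \<noteq> 0" and 2: "\<And>h. h \<in> I \<Longrightarrow> h \<noteq> 0 \<Longrightarrow> degree m \<le> degree h"
    unfolding m_def using arg_min_nat_lemma[of "\<lambda>h. h \<in> I \<and> h \<noteq> 0" \<pi> degree] mem nz by auto
  have add: "f + h \<in> I" if fh: "f \<in> I" "h \<in> I" for f h
  proof -
    obtain a b c d where "f = a * \<pi> + b * g" "h = c * \<pi> + d * g"
      using fh unfolding I_def by blast
    then have "f + h = (a + c) * \<pi> + (b + d) * g" by (simp add: algebra_simps)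
    then show ?thesis unfolding I_def by blast
  qed
  have mult: "r * f \<in> I" if f: "f \<in> I" for r f
  proof -
    obtain a b where "f = a * \<pi> + b * g" using f unfolding I_def by blast
    then have "r * f = (r * a) * \<pi> + (r * b) * g" by (simp add: algebra_simps)
    then show ?thesis unfolding I_def by blast
  qed
  have dvd: "m dvd h" if "h \<in> I" for h
    using poly_ideal_dvd[of I m h] add mult 1 2 that by blast
  have "degree m \<noteq> degree \<pi>"
  proof
    assume eq: "degree m = degree \<pi>"
    obtain r where r: "\<pi> = m * r" using dvd[OF mem(1)] by blast
    then have "r \<noteq> 0" "degree r = 0" using nz eq by (auto simp: degree_mult_eq)
    then have "r dvd 1" by (simp add: degree_0_dvd)
    then have "\<pi> dvd m" using r by (simp add: mult_unit_dvd_iff)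
    then show False using dvd[OF mem(2)] assms(2) dvd_trans by blast
  qed
  then have "degree m = 0" using assms(1) dvd[OF mem(1)] unfolding irreducible_factor_def by blast
  then have "m dvd 1" using 1 by (simp add: degree_0_dvd)
  then obtain r where "1 = r * m" by (metis dvdE mult.commute)
  then have "1 \<in> I" using mult 1 by metis
  then show ?thesis unfolding I_def comaximal_def by auto
qed

text \<open>Stands in for unique factorization. A common irreducible factor \<open>\<pi>\<close> is
  cancelled and the induction gives a power of some \<open>\<rho>\<close> for the quotients. If
  \<open>\<rho>\<close> is associated to \<open>\<pi>\<close>, the exponent goes up by one;
  otherwise \<open>\<rho>\<close> is comaximal to \<open>\<pi>\<close> and the same power
  works.\<close>

lemma not_dvd_imp_irreducible_power:
  fixes f g :: "'a :: field poly"
  assumes "f \<noteq> 0" "g \<noteq> 0" "\<not> f dvd g"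
  shows "\<exists>\<pi> a. irreducible_factor \<pi> \<and> \<pi> ^ a dvd f \<and> \<not> \<pi> ^ a dvd g"
  using assms
proof (induction "degree f" arbitrary: f g rule: less_induct)
  case less
  have "degree f > 0" using less.prems degree_0_dvd by blast
  then obtain \<pi> where \<pi>: "irreducible_factor \<pi>" "\<pi> dvd f" by (rule exists_irreducible_factor)
  show ?case
  proof (cases "\<pi> dvd g")
    case False
    then show ?thesis using \<pi> by (metis power_one_right)
  next
    case True
    then obtain f' g' where fg: "f = \<pi> * f'" "g = \<pi> * g'" using \<pi> by blast
    have nz: "\<pi> \<noteq> 0" "f' \<noteq> 0" "g' \<noteq> 0" using less.prems fg by auto
    have "\<not> f' dvd g'" using less.prems(3) fg by (metis dvd_refl mult_dvd_mono)
    moreover have "degree f' < degree f"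
      using \<pi> nz fg by (simp add: degree_mult_eq irreducible_factor_def)
    ultimately obtain \<rho> a where \<rho>: "irreducible_factor \<rho>" "\<rho> ^ a dvd f'" "\<not> \<rho> ^ a dvd g'"
      using less.hyps nz by blast
    show ?thesis
    proof (cases "\<rho> dvd \<pi>")
      case False
      then have "comaximal (\<rho> ^ a) \<pi>"
        using \<rho> by (simp add: irreducible_factor_comaximal comaximal_power_left)
      then have "\<not> \<rho> ^ a dvd g" using \<rho> fg comaximal_dvd_mult by blast
      then show ?thesis using \<rho> fg by (metis dvd_mult)
    next
      case True
      then obtain h where h: "\<pi> = \<rho> * h" by blast
      have "degree \<rho> = degree \<pi>"
        using True \<rho>(1) \<pi>(1) unfolding irreducible_factor_def by fastforce
      then have "degree h = 0" "h \<noteq> 0" using h nz by (auto simp: degree_mult_eq)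
      then have unit: "h dvd 1" by (simp add: degree_0_dvd)
      have "\<rho> ^ Suc a dvd f" using \<rho>(2) unfolding fg h by (simp add: mult_dvd_mono)
      moreover have "\<not> \<rho> ^ Suc a dvd g"
      proof
        assume "\<rho> ^ Suc a dvd g"
        then have "\<rho> * \<rho> ^ a dvd \<rho> * (h * g')" unfolding fg h by (simp add: mult.assoc)
        then have "\<rho> ^ a dvd h * g'" using nz h by simp
        then show False using \<rho>(3) unit by (simp add: dvd_mult_unit_iff')
      qed
      ultimately show ?thesis using \<rho>(1) by blast
    qed
  qed
qed

text \<open>The point is that \<open>\<pi> ^ a * g'\<close> has larger degree than \<open>g\<close>.
  Here \<open>b\<close> is the exact multiplicity of \<open>\<pi>\<close> in \<open>g\<close>, which
  makes \<open>g'\<close> comaximal to powers of \<open>\<pi>\<close>; \<open>a\<close> may be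
  smaller than the multiplicity in \<open>f\<close>.\<close>

lemma not_dvd_imp_split:
  fixes f g :: "'a :: field poly"
  assumes "f \<noteq> 0" "g \<noteq> 0" "\<not> f dvd g"
  obtains \<pi> a b f' g' where "f = \<pi> ^ a * f'" "g = \<pi> ^ b * g'" "b < a" "degree \<pi> > 0"
    "comaximal (\<pi> ^ a) g'"
proof -
  obtain \<pi> a where \<pi>: "irreducible_factor \<pi>" "\<pi> ^ a dvd f" "\<not> \<pi> ^ a dvd g"
    using not_dvd_imp_irreducible_power[OF assms] by blast
  \<comment> \<open>The maximum exists: the exponents are bounded by \<open>a\<close>, because
    \<open>\<pi> ^ a\<close> does not divide \<open>g\<close>.\<close>
  define b where "b = Greatest (\<lambda>b. \<pi> ^ b dvd g)"
  have bd: "j \<le> a" if "\<pi> ^ j dvd g" for j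
    using that \<pi>(3) by (meson dvd_trans le_imp_power_dvd nat_le_linear)
  have b: "\<pi> ^ b dvd g" unfolding b_def by (rule GreatestI_nat[of _ 0 a]) (auto simp: bd)
  have b': "j \<le> b" if "\<pi> ^ j dvd g" for j
    unfolding b_def by (rule Greatest_le_nat[of _ _ a]) (auto simp: bd that)
  obtain f' g' where fg: "f = \<pi> ^ a * f'" "g = \<pi> ^ b * g'" using b \<pi>(2) by blast
  have "b < a" using bd[OF b] b \<pi>(3) by (metis le_neq_implies_less)
  moreover have "\<not> \<pi> dvd g'"
  proof
    assume "\<pi> dvd g'"
    then have "\<pi> ^ Suc b dvd g" unfolding fg by (simp add: mult.commute mult_dvd_mono)
    then show False using b' by fastforce
  qed
  then have "comaximal (\<pi> ^ a) g'"
    using \<pi>(1) by (simp add: irreducible_factor_comaximal comaximal_power_left)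
  ultimately show ?thesis using that fg \<pi>(1) unfolding irreducible_factor_def by blast
qed

section \<open>Cyclic vectors\<close>

lemma poly_mat_carrier [simp]:
  "A \<in> carrier_mat n n \<Longrightarrow> poly_mat f A \<in> carrier_mat n n"
  unfolding poly_mat_def by auto

lemma dim_poly_mat [simp]: "dim_row (poly_mat f A) = dim_row A" "dim_col (poly_mat f A) = dim_row A"
  unfolding poly_mat_def by auto

lemma poly_mat_entry:
  assumes "A \<in> carrier_mat n n" "i < n" "j < n" "degree f \<le> N"
  shows "poly_mat f A $$ (i, j) = (\<Sum>k\<le>N. coeff f k * (A ^\<^sub>m k) $$ (i, j))"
  using assms by (intro poly_mat_index) auto

lemma poly_mat_add:
  assumes A: "A \<in> carrier_mat n n"
  shows "poly_mat (f + g) A = poly_mat f A + poly_mat g A"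
proof (rule eq_matI)
  fix i j assume "i < dim_row (poly_mat f A + poly_mat g A)" "j < dim_col (poly_mat f A + poly_mat g A)"
  then have ij: "i < n" "j < n"
    using carrier_matD[OF poly_mat_carrier[OF A]] by auto
  let ?N = "max (degree f) (degree g)"
  have "degree (f + g) \<le> ?N" by (rule degree_add_le_max)
  then show "poly_mat (f + g) A $$ (i, j) = (poly_mat f A + poly_mat g A) $$ (i, j)"
    using ij carrier_matD[OF poly_mat_carrier[OF A]]
    by (simp add: poly_mat_entry[OF A ij, of _ ?N] distrib_right sum.distrib)
qed (use carrier_matD[OF poly_mat_carrier[OF A]] in auto)

lemma poly_mat_smult:
  assumes A: "A \<in> carrier_mat n n"
  shows "poly_mat (Polynomial.smult c f) A = c \<cdot>\<^sub>m poly_mat f A"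
proof (rule eq_matI)
  fix i j assume "i < dim_row (c \<cdot>\<^sub>m poly_mat f A)" "j < dim_col (c \<cdot>\<^sub>m poly_mat f A)"
  then have ij: "i < n" "j < n"
    using carrier_matD[OF poly_mat_carrier[OF A]] by auto
  then show "poly_mat (Polynomial.smult c f) A $$ (i, j) = (c \<cdot>\<^sub>m poly_mat f A) $$ (i, j)"
    using carrier_matD[OF poly_mat_carrier[OF A]]
    by (simp add: poly_mat_entry[OF A ij, of _ "degree f"] degree_smult_le sum_distrib_left mult.assoc)
qed (use carrier_matD[OF poly_mat_carrier[OF A]] in auto)

lemma poly_mat_0:
  assumes A: "A \<in> carrier_mat n n"
  shows "poly_mat 0 A = 0\<^sub>m n n"
  using assms by (intro eq_matI) (auto simp: poly_mat_def)

text \<open>The Horner recursion, which turns multiplicativity of evaluation into an induction over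
  the coefficients.\<close>

lemma poly_mat_pCons:
  assumes A: "A \<in> carrier_mat n n"
  shows "poly_mat (pCons a f) A = a \<cdot>\<^sub>m 1\<^sub>m n + poly_mat f A * A"
proof (rule eq_matI)
  fix i j assume "i < dim_row (a \<cdot>\<^sub>m 1\<^sub>m n + poly_mat f A * A)" "j < dim_col (a \<cdot>\<^sub>m 1\<^sub>m n + poly_mat f A * A)"
  then have ij: "i < n" "j < n" using A by auto
  note pc = carrier_matD[OF pow_carrier_mat[OF A]]
  have "poly_mat (pCons a f) A $$ (i, j) =
      (\<Sum>k\<le>Suc (degree f). coeff (pCons a f) k * (A ^\<^sub>m k) $$ (i, j))"
    by (rule poly_mat_entry[OF A ij]) (simp add: degree_pCons_le)
  also have "\<dots> = a * 1\<^sub>m n $$ (i, j) + (\<Sum>k\<le>degree f. coeff f k * (A ^\<^sub>m k * A) $$ (i, j))"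
    using A by (subst sum.atMost_Suc_shift) (simp add: coeff_pCons)
  also have "(\<Sum>k\<le>degree f. coeff f k * (A ^\<^sub>m k * A) $$ (i, j)) =
      (\<Sum>k\<le>degree f. \<Sum>l<n. coeff f k * (A ^\<^sub>m k) $$ (i, l) * A $$ (l, j))"
    using A ij pc
    by (intro sum.cong refl) (simp add: scalar_prod_def sum_distrib_left mult.assoc atLeast0LessThan)
  also have "\<dots> = (\<Sum>l<n. poly_mat f A $$ (i, l) * A $$ (l, j))"
    by (subst sum.swap, intro sum.cong refl)
      (simp add: poly_mat_entry[OF A ij(1), of _ f "degree f"] sum_distrib_right)
  also have "\<dots> = (poly_mat f A * A) $$ (i, j)"
    using A ij carrier_matD[OF poly_mat_carrier[OF A]] by (simp add: scalar_prod_def atLeast0LessThan)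
  finally show "poly_mat (pCons a f) A $$ (i, j) = (a \<cdot>\<^sub>m 1\<^sub>m n + poly_mat f A * A) $$ (i, j)"
    using ij A carrier_matD[OF poly_mat_carrier[OF A]] by simp
qed (use A carrier_matD[OF poly_mat_carrier[OF A]] in auto)

lemma poly_mat_mult:
  assumes A: "A \<in> carrier_mat n n"
  shows "poly_mat (f * g) A = poly_mat f A * poly_mat g A"
proof (induction g)
  case 0
  then show ?case by (simp add: poly_mat_0[OF A] right_mult_zero_mat[OF poly_mat_carrier[OF A]])
next
  case (pCons a g)
  note [simp] = poly_mat_carrier[OF A]
  have "poly_mat (f * pCons a g) A = a \<cdot>\<^sub>m poly_mat f A + poly_mat (pCons 0 (f * g)) A"
    by (simp add: poly_mat_add[OF A] poly_mat_smult[OF A])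
  also have "poly_mat (pCons 0 (f * g)) A = poly_mat f A * poly_mat g A * A"
    using pCons A by (auto simp: poly_mat_pCons[OF A] intro!: eq_matI)
  also have "a \<cdot>\<^sub>m poly_mat f A + poly_mat f A * poly_mat g A * A =
      poly_mat f A * (a \<cdot>\<^sub>m 1\<^sub>m n + poly_mat g A * A)"
    using A by (subst mult_add_distrib_mat[of _ n n _ n])
      (auto simp: mult_smult_distrib[of _ n n _ n] assoc_mult_mat[of _ n n _ n _ n])
  finally show ?case by (simp add: poly_mat_pCons[OF A])
qed

section \<open>Column vectors as a module over the polynomial ring, with the variable acting as
  \<open>A\<close>\<close>

definition poly_act :: "'a :: comm_ring_1 mat \<Rightarrow> 'a poly \<Rightarrow> 'a vec \<Rightarrow> 'a vec" where
  "poly_act A f v = poly_mat f A *\<^sub>v v"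

context
  fixes A :: "'a :: comm_ring_1 mat" and n :: nat
  assumes A: "A \<in> carrier_mat n n"
begin

lemma poly_act_carrier [simp]: "poly_act A f v \<in> carrier_vec n"
  unfolding poly_act_def using A by (intro carrier_vecI) auto

lemma poly_act_add:
  "v \<in> carrier_vec n \<Longrightarrow> poly_act A (f + g) v = poly_act A f v + poly_act A g v"
  unfolding poly_act_def poly_mat_add[OF A]
  by (rule add_mult_distrib_mat_vec[of _ n n]) (use poly_mat_carrier[OF A] in auto)

lemma poly_act_smult:
  "v \<in> carrier_vec n \<Longrightarrow> poly_act A (Polynomial.smult c f) v = c \<cdot>\<^sub>v poly_act A f v"
  unfolding poly_act_def poly_mat_smult[OF A]
  by (rule eq_vecI) (use carrier_matD[OF poly_mat_carrier[OF A]] in auto)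

lemma poly_act_mult:
  "v \<in> carrier_vec n \<Longrightarrow> poly_act A (f * g) v = poly_act A f (poly_act A g v)"
  unfolding poly_act_def poly_mat_mult[OF A]
  by (rule assoc_mult_mat_vec[of _ n n _ n]) (use poly_mat_carrier[OF A] in auto)

lemma poly_act_0 [simp]: "v \<in> carrier_vec n \<Longrightarrow> poly_act A 0 v = 0\<^sub>v n"
  unfolding poly_act_def poly_mat_0[OF A] by auto

lemma poly_mat_1: "poly_mat 1 A = 1\<^sub>m n"
  unfolding one_pCons poly_mat_pCons[OF A] poly_mat_0[OF A] using A by (intro eq_matI) auto

lemma poly_mat_X: "poly_mat [:0, 1:] A = A"
  unfolding poly_mat_pCons[OF A, of 0] one_pCons[symmetric] poly_mat_1
  using A by (intro eq_matI) auto

lemma poly_act_X: "v \<in> carrier_vec n \<Longrightarrow> poly_act A [:0, 1:] v = A *\<^sub>v v"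
  unfolding poly_act_def poly_mat_X by simp

lemma poly_act_zero_vec [simp]: "poly_act A f (0\<^sub>v n) = 0\<^sub>v n"
  unfolding poly_act_def using A by (intro eq_vecI) (auto simp: scalar_prod_def)

lemma poly_act_add_vec:
  "u \<in> carrier_vec n \<Longrightarrow> v \<in> carrier_vec n \<Longrightarrow>
    poly_act A f (u + v) = poly_act A f u + poly_act A f v"
  unfolding poly_act_def by (rule mult_add_distrib_mat_vec[of _ n n]) (use poly_mat_carrier[OF A] in auto)

lemma poly_act_dvd:
  assumes "v \<in> carrier_vec n" "poly_act A f v = 0\<^sub>v n" "f dvd g"
  shows "poly_act A g v = 0\<^sub>v n"
proof -
  obtain h where "g = h * f" using assms(3) by (metis dvdE mult.commute)
  then show ?thesis using assms by (simp add: poly_act_mult)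
qed

lemma poly_act_zero_imp_poly_mat_zero:
  assumes "\<And>v. v \<in> carrier_vec n \<Longrightarrow> poly_act A f v = 0\<^sub>v n"
  shows "poly_mat f A = 0\<^sub>m n n"
proof (rule eq_matI)
  fix i j assume "i < dim_row (0\<^sub>m n n :: 'a mat)" "j < dim_col (0\<^sub>m n n :: 'a mat)"
  then have ij: "i < n" "j < n" by auto
  have "poly_mat f A $$ (i, j) = (poly_mat f A *\<^sub>v unit_vec n j) $ i"
    using ij carrier_matD[OF poly_mat_carrier[OF A]] by simp
  also have "\<dots> = 0" using assms[of "unit_vec n j"] ij by (simp add: poly_act_def)
  finally show "poly_mat f A $$ (i, j) = 0\<^sub>m n n $$ (i, j)" using ij by simp
qed (use carrier_matD[OF poly_mat_carrier[OF A]] in auto)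

end

text \<open>A generator of the order ideal of \<open>v\<close>, unique only up to a nonzero constant
  factor.\<close>

definition annihilator :: "'a :: field mat \<Rightarrow> nat \<Rightarrow> 'a vec \<Rightarrow> 'a poly \<Rightarrow> bool" where
  "annihilator A n v f \<longleftrightarrow> f \<noteq> 0 \<and> (\<forall>g. poly_act A g v = 0\<^sub>v n \<longleftrightarrow> f dvd g)"

lemma exists_annihilator:
  fixes A :: "'a :: field mat"
  assumes A: "A \<in> carrier_mat n n" and v: "v \<in> carrier_vec n"
    and h: "h \<noteq> 0" "poly_act A h v = 0\<^sub>v n"
  obtains f where "annihilator A n v f"
proof -
  define I where "I = {f. poly_act A f v = 0\<^sub>v n}"
  define m where "m = arg_min degree (\<lambda>h. h \<in> I \<and> h \<noteq> 0)"
  have 1: "m \<in> I" "m \<noteq> 0" and 2: "\<And>h. h \<in> I \<Longrightarrow> h \<noteq> 0 \<Longrightarrow> degree m \<le> degree h"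
    unfolding m_def using arg_min_nat_lemma[of "\<lambda>h. h \<in> I \<and> h \<noteq> 0" h degree] h by (auto simp: I_def)
  have add: "f + g \<in> I" if "f \<in> I" "g \<in> I" for f g
    using that by (simp add: I_def poly_act_add[OF A v])
  have mult: "r * f \<in> I" if "f \<in> I" for r f
    using that by (simp add: I_def poly_act_mult[OF A v] poly_act_zero_vec[OF A])
  have "m dvd g" if "g \<in> I" for g
    by (rule poly_ideal_dvd[of I, OF add mult 1 2 that])
  moreover have "g \<in> I" if "m dvd g" for g
    using poly_act_dvd[OF A v _ that] 1(1) by (simp add: I_def)
  ultimately have "annihilator A n v m"
    unfolding annihilator_def using 1(2) by (auto simp: I_def)
  then show ?thesis using that by blast
qed

text \<open>\<open>f * g\<close> divides \<open>f * h\<close> exactly when \<open>g\<close> divides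
  \<open>h\<close>. Passing to a multiple of \<open>v\<close> thus isolates a chosen factor of its
  annihilator.\<close>

lemma annihilator_act:
  fixes A :: "'a :: field mat"
  assumes A: "A \<in> carrier_mat n n" and v: "v \<in> carrier_vec n"
    and ann: "annihilator A n v (f * g)"
  shows "annihilator A n (poly_act A f v) g"
proof -
  have nz: "f \<noteq> 0" "g \<noteq> 0" using ann unfolding annihilator_def by auto
  have "poly_act A h (poly_act A f v) = 0\<^sub>v n \<longleftrightarrow> g dvd h" for h
  proof -
    have "poly_act A h (poly_act A f v) = poly_act A (f * h) v"
      by (metis A v poly_act_mult mult.commute)
    then show ?thesis using ann nz unfolding annihilator_def by simp
  qed
  then show ?thesis using nz unfolding annihilator_def by blast
qed

text \<open>If \<open>h\<close> kills \<open>u + v\<close>, then \<open>g * h\<close> kills the sum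
  and \<open>v\<close>, hence also \<open>u\<close>; so \<open>f\<close> divides
  \<open>g * h\<close> and, by comaximality, \<open>h\<close>. Exchanging the roles gives
  \<open>g dvd h\<close>.\<close>

lemma annihilator_add:
  fixes A :: "'a :: field mat"
  assumes A: "A \<in> carrier_mat n n" and u: "u \<in> carrier_vec n" and v: "v \<in> carrier_vec n"
    and f: "annihilator A n u f" and g: "annihilator A n v g" and co: "comaximal f g"
  shows "annihilator A n (u + v) (f * g)"
proof -
  have fu: "poly_act A f u = 0\<^sub>v n" and gv: "poly_act A g v = 0\<^sub>v n"
    using f g unfolding annihilator_def by auto
  note C = poly_act_carrier[OF A]
  have "poly_act A h (u + v) = 0\<^sub>v n \<longleftrightarrow> f * g dvd h" for h
  proof
    assume h: "poly_act A h (u + v) = 0\<^sub>v n"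
    have "poly_act A (g * h) (u + v) = poly_act A (g * h) u + poly_act A (h * g) v"
      by (simp add: poly_act_add_vec[OF A u v] mult.commute)
    also have "\<dots> = poly_act A (g * h) u"
      using C by (simp add: poly_act_mult[OF A v] gv A)
    finally have "poly_act A (g * h) u = 0\<^sub>v n"
      using h u v by (simp add: poly_act_mult[OF A] A)
    then have 1: "f dvd h" using f co comaximal_dvd_mult unfolding annihilator_def by blast
    have "poly_act A (f * h) (u + v) = poly_act A (h * f) u + poly_act A (f * h) v"
      by (simp add: poly_act_add_vec[OF A u v] mult.commute)
    also have "\<dots> = poly_act A (f * h) v"
      using C by (simp add: poly_act_mult[OF A u] fu A)
    finally have "poly_act A (f * h) v = 0\<^sub>v n"
      using h u v by (simp add: poly_act_mult[OF A] A)
    then have 2: "g dvd h"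
      using g co comaximal_dvd_mult comaximal_sym unfolding annihilator_def by blast
    show "f * g dvd h" using comaximal_mult_dvd[OF co 1 2] .
  next
    assume "f * g dvd h"
    then have "f dvd h" "g dvd h" by (auto dest: dvd_mult_left dvd_mult_right)
    then have "poly_act A h u = 0\<^sub>v n" "poly_act A h v = 0\<^sub>v n"
      using poly_act_dvd[OF A u fu] poly_act_dvd[OF A v gv] by auto
    then show "poly_act A h (u + v) = 0\<^sub>v n" by (simp add: poly_act_add_vec[OF A u v])
  qed
  then show ?thesis using f g unfolding annihilator_def by simp
qed

lemma exists_annihilator_eq_min_poly:
  fixes A :: "'a :: field mat"
  assumes A: "A \<in> carrier_mat n n" and h: "h \<noteq> 0" "poly_mat h A = 0\<^sub>m n n"
  obtains v f where "v \<in> carrier_vec n" "annihilator A n v f" "poly_mat f A = 0\<^sub>m n n"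
proof -
  have hv: "poly_act A h v = 0\<^sub>v n" if "v \<in> carrier_vec n" for v
    unfolding poly_act_def h(2) using that by (intro eq_vecI) auto
  \<comment> \<open>The degrees of annihilators are inhabited through the zero vector and bounded by
    \<open>degree h\<close>, since \<open>h\<close> kills every vector. So some \<open>v\<close> has
    an annihilator of maximal degree.\<close>
  define P where "P = (\<lambda>N. \<exists>v f. v \<in> carrier_vec n \<and> annihilator A n v f \<and> degree f = N)"
  obtain f0 where "annihilator A n (0\<^sub>v n) f0" 
    using exists_annihilator[OF A zero_carrier_vec h(1) hv[OF zero_carrier_vec]] by blast
  then have P0: "P (degree f0)" unfolding P_def by (metis zero_carrier_vec)
  have bound: "N \<le> degree h" if "P N" for N
    using that h(1) hv unfolding P_def annihilator_def by (auto intro!: dvd_imp_degree_le)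
  define N where "N = Greatest P"
  have "P N" unfolding N_def by (rule GreatestI_nat[of P, OF P0]) (rule bound)
  then obtain v f where v: "v \<in> carrier_vec n" and f: "annihilator A n v f" and N: "degree f = N"
    unfolding P_def by blast
  have max: "degree g \<le> degree f" if "u \<in> carrier_vec n" "annihilator A n u g" for u g
    unfolding N N_def by (rule Greatest_le_nat[of P _ "degree h"]) (use that bound in \<open>auto simp: P_def\<close>)
  have "poly_act A f u = 0\<^sub>v n" if u: "u \<in> carrier_vec n" for u
  proof -
    obtain g where g: "annihilator A n u g" using exists_annihilator[OF A u h(1) hv[OF u]] by blast
    \<comment> \<open>Otherwise some prime power divides \<open>g\<close> more often than \<open>f\<close>, and combining the corresponding parts
      of \<open>u\<close> and \<open>v\<close> gives a vector with an annihilator of larger degree than \<open>f\<close>.\<close>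
    have "g dvd f"
    proof (rule ccontr)
      assume "\<not> g dvd f"
      moreover have nz: "g \<noteq> 0" "f \<noteq> 0" using f g unfolding annihilator_def by auto
      ultimately obtain \<pi> a b g' f' where s: "g = \<pi> ^ a * g'" "f = \<pi> ^ b * f'" "b < a" "degree \<pi> > 0"
        "comaximal (\<pi> ^ a) f'"
        using not_dvd_imp_split by metis
      have 1: "annihilator A n (poly_act A g' u) (\<pi> ^ a)"
        by (rule annihilator_act[OF A u]) (use g s in \<open>simp add: mult.commute\<close>)
      have 2: "annihilator A n (poly_act A (\<pi> ^ b) v) f'"
        by (rule annihilator_act[OF A v]) (use f s in simp)
      have "annihilator A n (poly_act A g' u + poly_act A (\<pi> ^ b) v) (\<pi> ^ a * f')"
        by (rule annihilator_add[OF A _ _ 1 2 s(5)]) (simp_all add: A)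
      then have "degree (\<pi> ^ a * f') \<le> degree f" by (rule max[rotated]) (simp add: A)
      moreover have "\<pi> \<noteq> 0" "f' \<noteq> 0" using nz s by auto
      ultimately show False using s(3,4) unfolding s(2)
        by (simp add: degree_mult_eq degree_power_eq)
    qed
    then show ?thesis using g unfolding annihilator_def by blast
  qed
  then have "poly_mat f A = 0\<^sub>m n n" by (rule poly_act_zero_imp_poly_mat_zero[OF A])
  then show ?thesis using that v f by blast
qed

text \<open>Some vector has an annihilator \<open>f\<close> that kills all of \<open>A\<close>. Its
  degree is then at least that of the minimal polynomial, which is \<open>n\<close> for a cyclic
  matrix.\<close>

lemma cyclic_mat_cyclic_vector:
  fixes A :: "'a :: field mat"
  assumes A: "A \<in> carrier_mat n n" and cyc: "cyclic_mat A"
  obtains v where "v \<in> carrier_vec n"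
    "\<And>g. degree g < n \<Longrightarrow> poly_act A g v = 0\<^sub>v n \<Longrightarrow> g = 0"
proof -
  have mp: "is_min_poly A (char_poly A)" using cyc unfolding cyclic_mat_def by blast
  have deg: "degree (char_poly A) = n" using degree_monic_char_poly[OF A] by simp
  have "char_poly A \<noteq> 0" "poly_mat (char_poly A) A = 0\<^sub>m n n"
    using mp A unfolding is_min_poly_def by auto
  then obtain v f where v: "v \<in> carrier_vec n" "annihilator A n v f" "poly_mat f A = 0\<^sub>m n n"
    by (rule exists_annihilator_eq_min_poly[OF A])
  have "n \<le> degree f" using v mp A deg unfolding is_min_poly_def annihilator_def by auto
  moreover have "g = 0 \<or> degree f \<le> degree g" if "poly_act A g v = 0\<^sub>v n" for g
    using that v(2) dvd_imp_degree_le[of f g] unfolding annihilator_def by blast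
  ultimately show ?thesis using that[OF v(1)] by fastforce
qed

section \<open>Hessenberg form\<close>

lemma mat_trace_mult_comm:
  fixes X Y :: "'a :: comm_ring_1 mat"
  assumes X: "X \<in> carrier_mat n n" and Y: "Y \<in> carrier_mat n n"
  shows "mat_trace (X * Y) = mat_trace (Y * X)"
proof -
  have "mat_trace (X * Y) = (\<Sum>i<n. \<Sum>l<n. X $$ (i, l) * Y $$ (l, i))"
    using X Y by (simp add: mat_trace_def scalar_prod_def atLeast0LessThan)
  also have "\<dots> = (\<Sum>l<n. \<Sum>i<n. Y $$ (l, i) * X $$ (i, l))"
    by (subst sum.swap) (simp add: mult.commute)
  also have "\<dots> = mat_trace (Y * X)"
    using X Y by (simp add: mat_trace_def scalar_prod_def atLeast0LessThan)
  finally show ?thesis .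
qed

lemma mat_trace_similar:
  fixes A H :: "'a :: comm_ring_1 mat"
  assumes A: "A \<in> carrier_mat n n" and wit: "similar_mat_wit A H P Q"
  shows "mat_trace A = mat_trace H"
proof -
  have c: "H \<in> carrier_mat n n" "P \<in> carrier_mat n n" "Q \<in> carrier_mat n n"
    and QP: "Q * P = 1\<^sub>m n" and AP: "A = P * H * Q"
    using wit A unfolding similar_mat_wit_def Let_def by auto
  have "mat_trace A = mat_trace (Q * (P * H))"
    unfolding AP using c by (intro mat_trace_mult_comm[of _ n]) auto
  also have "Q * (P * H) = H"
    using c QP by (simp add: assoc_mult_mat[of Q n n P n H n, symmetric])
  finally show ?thesis .
qed

text \<open>The coefficient in the top degree comes from the last polynomial alone, so the scalars
  vanish from the top downwards.\<close>

lemma graded_polys_independent: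
  fixes g :: "nat \<Rightarrow> 'a :: field poly"
  assumes "\<And>i. degree (g i) = i" "\<And>i. g i \<noteq> 0"
  shows "(\<Sum>i<m. Polynomial.smult (c i) (g i)) = 0 \<Longrightarrow> i < m \<Longrightarrow> c i = 0"
proof (induction m arbitrary: i)
  case (Suc m)
  have "coeff (\<Sum>i<m. Polynomial.smult (c i) (g i)) m = 0"
    using assms by (auto simp: coeff_sum coeff_eq_0 intro!: sum.neutral)
  then have "coeff (\<Sum>i<Suc m. Polynomial.smult (c i) (g i)) m = c m * coeff (g m) m"
    by simp
  then have "c m * coeff (g m) m = 0" unfolding Suc.prems(1) by simp
  moreover have "coeff (g m) m \<noteq> 0" using assms[of m] by (metis leading_coeff_0_iff)
  ultimately have "c m = 0" by simp
  then show ?case using Suc.IH Suc.prems by (auto simp: less_Suc_eq)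
qed simp

text \<open>The matrix of an operator that sends each basis vector \<open>b i\<close> except the
  last to \<open>a i\<close> times \<open>b i\<close> plus \<open>b (i + 1)\<close>, while
  \<open>c\<close> holds the coordinates of the image of the last one. For \<open>a = 0\<close> it
  is a companion matrix.\<close>

definition hessenberg_mat :: "nat \<Rightarrow> (nat \<Rightarrow> 'a :: comm_ring_1) \<Rightarrow> (nat \<Rightarrow> 'a) \<Rightarrow> 'a mat" where
  "hessenberg_mat n a c = mat n n (\<lambda>(i, j). if Suc j = n then c i else
     if i = j then a j else if i = Suc j then 1 else 0)"

lemma hessenberg_mat_carrier [simp]: "hessenberg_mat n a c \<in> carrier_mat n n"
  unfolding hessenberg_mat_def by simp

lemma mat_trace_hessenberg:
  "n > 0 \<Longrightarrow> mat_trace (hessenberg_mat n a c) = (\<Sum>i<n-1. a i) + c (n - 1)"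
  unfolding mat_trace_def hessenberg_mat_def
  by (cases n) (auto simp: lessThan_Suc add.commute intro!: sum.cong)

lemma cyclic_mat_similar_hessenberg:
  fixes A :: "'a :: field mat" and a :: "nat \<Rightarrow> 'a"
  assumes A: "A \<in> carrier_mat n n" and cyc: "cyclic_mat A" and n: "n > 0"
  obtains P Q c where "similar_mat_wit A (hessenberg_mat n a c) P Q"
proof -
  obtain v where v: "v \<in> carrier_vec n"
    and inj: "\<And>g. degree g < n \<Longrightarrow> poly_act A g v = 0\<^sub>v n \<Longrightarrow> g = 0"
    using cyclic_mat_cyclic_vector[OF A cyc] by blast
  define g where "g = (\<lambda>i. \<Prod>j<i. [:- a j, 1:])"
  define b where "b = (\<lambda>i. poly_act A (g i) v)"
  have b: "b i \<in> carrier_vec n" for i unfolding b_def by (rule poly_act_carrier[OF A])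
  have gnz: "g i \<noteq> 0" for i unfolding g_def by simp
  have gdeg: "degree (g i) = i" for i
    unfolding g_def by (subst degree_prod_eq_sum_degree) auto
  \<comment> \<open>Splits the variable as \<open>a i\<close> plus the next linear factor; acting on
    \<open>v\<close>, this becomes column \<open>i\<close> of the Hessenberg matrix.\<close>
  have g_Suc: "[:0, 1:] * g i = Polynomial.smult (a i) (g i) + g (Suc i)" for i
  proof -
    have "[:0, 1:] = [:a i:] + [:- a i, 1:]" by simp
    then have "[:0, 1:] * g i = [:a i:] * g i + [:- a i, 1:] * g i"
      by (simp only: distrib_right)
    then show ?thesis by (simp add: g_def mult.commute)
  qed
  have Ab: "A *\<^sub>v b i = a i \<cdot>\<^sub>v b i + b (Suc i)" for i
  proof -
    have "A *\<^sub>v b i = poly_act A ([:0, 1:] * g i) v"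
      unfolding b_def poly_act_mult[OF A v] by (simp add: poly_act_X[OF A] A)
    then show ?thesis
      unfolding g_Suc b_def by (simp add: poly_act_add[OF A v] poly_act_smult[OF A v])
  qed
  define P where "P = mat n n (\<lambda>(r, i). b i $ r)"
  have P: "P \<in> carrier_mat n n" unfolding P_def by simp
  have sum_act: "poly_act A (\<Sum>i<m. Polynomial.smult (e i) (g i)) v $ r = (\<Sum>i<m. e i * b i $ r)"
    if r: "r < n" for m r and e :: "nat \<Rightarrow> 'a"
  proof (induction m)
    case (Suc m)
    then show ?case
      using r b[of m] carrier_vecD[OF poly_act_carrier[OF A]]
      by (simp add: poly_act_add[OF A v] poly_act_smult[OF A v] b_def)
  qed (use r v in \<open>simp add: poly_act_0[OF A]\<close>)
  have Pe: "P *\<^sub>v e = poly_act A (\<Sum>i<n. Polynomial.smult (e $ i) (g i)) v"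
    if e: "e \<in> carrier_vec n" for e
    by (rule eq_vecI)
      (use e carrier_vecD[OF poly_act_carrier[OF A]] in
        \<open>auto simp: P_def scalar_prod_def sum_act atLeast0LessThan mult.commute\<close>)
  \<comment> \<open>A kernel vector \<open>e\<close> gives a combination of the \<open>g i\<close>,
    of degree below \<open>n\<close>, that kills \<open>v\<close>. Cyclicity of \<open>v\<close>
    makes it zero, and then \<open>e\<close> is zero because the \<open>g i\<close> have distinct
    degrees.\<close>
  have "det P \<noteq> 0"
  proof
    assume "det P = 0"
    then obtain e where e: "e \<in> carrier_vec n" "e \<noteq> 0\<^sub>v n" "P *\<^sub>v e = 0\<^sub>v n"
      using det_0_iff_vec_prod_zero_field[OF P] by blast
    let ?f = "\<Sum>i<n. Polynomial.smult (e $ i) (g i)"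
    have "degree ?f \<le> n - 1"
      by (rule degree_sum_le) (use gdeg in \<open>auto intro: order_trans[OF degree_smult_le]\<close>)
    then have "?f = 0" using inj[of ?f] n e by (simp add: Pe)
    then have "e $ i = 0" if "i < n" for i
      using graded_polys_independent[of g] gdeg gnz that by blast
    then have "e = 0\<^sub>v n" using e(1) by (intro eq_vecI) auto
    then show False using e(2) by blast
  qed
  then have "P \<in> Units (ring_mat TYPE('a) n ())" by (rule det_non_zero_imp_unit[OF P])
  then obtain Q where Q: "Q \<in> carrier_mat n n" and QP: "Q * P = 1\<^sub>m n" and PQ: "P * Q = 1\<^sub>m n"
    unfolding Units_def ring_mat_def by auto
  \<comment> \<open>As \<open>Q\<close> inverts \<open>P\<close>, these are the coordinates of the
    image of the last basis vector.\<close>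
  define c where "c = Q *\<^sub>v (A *\<^sub>v b (n - 1))"
  have c: "c \<in> carrier_vec n" 
    unfolding c_def by (intro mult_mat_vec_carrier[OF Q] mult_mat_vec_carrier[OF A] b)
  have Pc: "P *\<^sub>v c = A *\<^sub>v b (n - 1)"
    unfolding c_def using A P Q b[of "n - 1"]
    by (simp add: assoc_mult_mat_vec[of P n n Q n, symmetric] PQ)
  let ?H = "hessenberg_mat n a (\<lambda>i. c $ i)"
  have "A * P = P * ?H"
  proof (rule eq_matI)
    fix r j assume "r < dim_row (P * ?H)" "j < dim_col (P * ?H)"
    then have rj: "r < n" "j < n" using P by (auto simp: hessenberg_mat_def)
    have "col P j = b j" using rj b[of j] unfolding P_def by (intro eq_vecI) auto
    then have 1: "(A * P) $$ (r, j) = (A *\<^sub>v b j) $ r" using rj A P by simp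
    have 2: "(P * ?H) $$ (r, j) = (\<Sum>l<n. b l $ r * ?H $$ (l, j))"
      using rj by (simp add: P_def hessenberg_mat_def scalar_prod_def atLeast0LessThan)
    show "(A * P) $$ (r, j) = (P * ?H) $$ (r, j)"
    proof (cases "Suc j = n")
      case True
      have "(\<Sum>l<n. b l $ r * ?H $$ (l, j)) = (P *\<^sub>v c) $ r"
        using rj c True by (simp add: P_def hessenberg_mat_def scalar_prod_def atLeast0LessThan)
      moreover have "n - 1 = j" using True by simp
      ultimately show ?thesis unfolding 1 2 Pc by simp
    next
      case False
      have "(\<Sum>l<n. b l $ r * ?H $$ (l, j)) =
          (\<Sum>l<n. (if l = j then b l $ r * a j else 0) + (if l = Suc j then b l $ r else 0))"
        using rj False by (intro sum.cong) (auto simp: hessenberg_mat_def)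
      also have "\<dots> = b j $ r * a j + b (Suc j) $ r"
        using rj False by (simp add: sum.distrib)
      also have "\<dots> = (A *\<^sub>v b j) $ r"
        unfolding Ab using rj b[of j] b[of "Suc j"] by (simp add: mult.commute)
      finally show ?thesis unfolding 1 2 by simp
    qed
  qed (use A P in \<open>auto simp: hessenberg_mat_def\<close>)
  then have "P * ?H * Q = A * P * Q" by simp
  also have "\<dots> = A" using A by (simp add: assoc_mult_mat[OF A P Q] PQ)
  finally have "similar_mat_wit A ?H P Q"
    unfolding similar_mat_wit_def Let_def using A P Q PQ QP by auto
  then show ?thesis using that by blast
qed

section \<open>Powers of bidiagonal matrices\<close>

lemma index_mult_mat_sum:
  assumes "X \<in> carrier_mat n n" "Y \<in> carrier_mat n n" "i < n" "j < n"
  shows "(X * Y) $$ (i, j) = (\<Sum>l<n. X $$ (i, l) * Y $$ (l, j))"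
  using assms by (simp add: scalar_prod_def atLeast0LessThan)

text \<open>If \<open>E\<close> has no two consecutive elements, this is the conjugate of the diagonal matrix of \<open>g\<close> by
  the identity plus the entries \<open>s\<^sub>j\<close> at \<open>(j + 1, j)\<close> for \<open>j \<in> E\<close>; so it is multiplicative in \<open>g\<close>.\<close>

definition bidiag_mat :: "nat \<Rightarrow> nat set \<Rightarrow> (nat \<Rightarrow> 'a) \<Rightarrow> (nat \<Rightarrow> 'a) \<Rightarrow> 'a :: field mat" where
  "bidiag_mat n E s g = mat n n (\<lambda>(i, j). if i = j then g i else
     if i = Suc j \<and> j \<in> E then (g j - g i) * s j else 0)"

lemma bidiag_mat_carrier [simp]: "bidiag_mat n E s g \<in> carrier_mat n n"
  unfolding bidiag_mat_def by simp

lemma bidiag_mat_mult: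
  assumes E: "\<And>j. j \<in> E \<Longrightarrow> Suc j \<notin> E"
  shows "bidiag_mat n E s g * bidiag_mat n E s h = bidiag_mat n E s (\<lambda>i. g i * h i)"
proof (rule eq_matI)
  fix i j assume "i < dim_row (bidiag_mat n E s (\<lambda>i. g i * h i))"
    "j < dim_col (bidiag_mat n E s (\<lambda>i. g i * h i))"
  then have ij: "i < n" "j < n" by (auto simp: bidiag_mat_def)
  let ?G = "\<lambda>l. if i = l then g i else if i = Suc l \<and> l \<in> E then (g l - g i) * s l else 0"
  have "(bidiag_mat n E s g * bidiag_mat n E s h) $$ (i, j) =
      (\<Sum>l<n. ?G l * (if l = j then h l else if l = Suc j \<and> j \<in> E then (h j - h l) * s j else 0))"
    using ij by (simp add: bidiag_mat_def scalar_prod_def atLeast0LessThan)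
  \<comment> \<open>Column \<open>j\<close> of the second factor has at most two nonzero entries. At
    \<open>(j + 1, j)\<close> the terms with \<open>g (j + 1) * h j\<close> cancel, and two
    subdiagonal entries never meet because \<open>E\<close> has no consecutive elements.\<close>
  also have "\<dots> = (\<Sum>l<n. (if l = j then ?G l * h l else 0) +
      (if l = Suc j then (if j \<in> E then ?G l * ((h j - h l) * s j) else 0) else 0))"
    by (intro sum.cong) auto
  also have "\<dots> = ?G j * h j +
      (if Suc j < n \<and> j \<in> E then ?G (Suc j) * ((h j - h (Suc j)) * s j) else 0)"
    using ij by (simp add: sum.distrib)
  also have "\<dots> = bidiag_mat n E s (\<lambda>i. g i * h i) $$ (i, j)"
    using ij E[of j] by (auto simp: bidiag_mat_def algebra_simps)
  finally show "(bidiag_mat n E s g * bidiag_mat n E s h) $$ (i, j) =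
      bidiag_mat n E s (\<lambda>i. g i * h i) $$ (i, j)" .
qed (auto simp: bidiag_mat_def)

lemma bidiag_mat_pow:
  assumes E: "\<And>j. j \<in> E \<Longrightarrow> Suc j \<notin> E"
  shows "bidiag_mat n E s g ^\<^sub>m k = bidiag_mat n E s (\<lambda>i. g i ^ k)"
proof (induction k)
  case 0
  show ?case by (rule eq_matI) (auto simp: bidiag_mat_def)
next
  case (Suc k)
  then show ?case by (simp add: bidiag_mat_mult[OF E] mult.commute)
qed

text \<open>The corner is left out because the diagonal of the other summand supplies it; the
  summand carrying this column can then have a zero last row.\<close>

definition last_col_mat :: "nat \<Rightarrow> (nat \<Rightarrow> 'a) \<Rightarrow> 'a :: zero mat" where
  "last_col_mat n c = mat n n (\<lambda>(i, j). if Suc j = n \<and> Suc i < n then c i else 0)"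

lemma last_col_mat_carrier [simp]: "last_col_mat n c \<in> carrier_mat n n"
  unfolding last_col_mat_def by simp

text \<open>Every inner \<open>T * R\<close> collapses to \<open>R\<close>, leaving a single
  \<open>T\<close> at the end.\<close>

lemma pow_mat_mult_absorb:
  fixes R T :: "'a :: comm_ring_1 mat"
  assumes R: "R \<in> carrier_mat n n" and T: "T \<in> carrier_mat n n" and TR: "T * R = R" and k: "k \<ge> 1"
  shows "(R * T) ^\<^sub>m k = R ^\<^sub>m k * T"
  using k
proof (induction k rule: nat_induct_at_least)
  case base
  show ?case using R T by simp
next
  case (Suc m)
  have Rm: "R ^\<^sub>m m \<in> carrier_mat n n" using R by simp
  have "(R * T) ^\<^sub>m Suc m = R ^\<^sub>m m * T * (R * T)" using Suc by simp
  also have "\<dots> = R ^\<^sub>m m * (T * R * T)"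
    using R T Rm by (simp add: assoc_mult_mat[of _ n n _ n _ n])
  also have "\<dots> = R ^\<^sub>m Suc m * T"
    unfolding TR using R T Rm by (simp add: assoc_mult_mat[of _ n n _ n _ n])
  finally show ?case .
qed

lemma bidiag_plus_last_col_power:
  fixes \<xi> c :: "nat \<Rightarrow> 'a :: field"
  assumes E: "\<And>j. j \<in> E \<Longrightarrow> Suc j \<notin> E" and En: "\<And>j. j \<in> E \<Longrightarrow> Suc (Suc j) < n"
    and nz: "\<And>i. Suc i < n \<Longrightarrow> \<xi> i \<noteq> 0" and last: "\<xi> (n - 1) = 0" and k: "k \<ge> 1"
  shows "\<exists>B \<in> carrier_mat n n.
    B ^\<^sub>m k = bidiag_mat n E s (\<lambda>i. \<xi> i ^ k) + last_col_mat n c"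
proof -
  \<comment> \<open>With \<open>V\<close> inverting \<open>D\<close> except for \<open>inverse 0 = 0\<close> in the last place, \<open>D * T = D + C\<close> and \<open>T * R = R\<close>,
    hence \<open>(R * T)\<^sup>k = R\<^sup>k * T = D + C\<close>.\<close>
  define R where "R = bidiag_mat n E s \<xi>"
  define D where "D = bidiag_mat n E s (\<lambda>i. \<xi> i ^ k)"
  define V where "V = bidiag_mat n E s (\<lambda>i. inverse (\<xi> i ^ k))"
  define C where "C = last_col_mat n c"
  define T where "T = 1\<^sub>m n + V * C"
  have carr: "R \<in> carrier_mat n n" "D \<in> carrier_mat n n" "V \<in> carrier_mat n n" "C \<in> carrier_mat n n"
    unfolding R_def D_def V_def C_def by simp_all
  then have T: "T \<in> carrier_mat n n" unfolding T_def by simp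
  \<comment> \<open>\<open>C\<close> is supported in the last column, and the last row of
    \<open>R\<close> is zero: \<open>\<xi> (n - 1) = 0\<close>, and \<open>En\<close> keeps
    \<open>n - 2\<close> out of \<open>E\<close>.\<close>
  have CR: "C * R = 0\<^sub>m n n"
  proof (rule eq_matI)
    fix i j assume "i < dim_row (0\<^sub>m n n :: 'a mat)" "j < dim_col (0\<^sub>m n n :: 'a mat)"
    then have ij: "i < n" "j < n" by auto
    have "C $$ (i, l) * R $$ (l, j) = 0" if "l < n" for l
      using that ij En[of j] last by (cases "Suc l = n")
        (auto simp: C_def R_def last_col_mat_def bidiag_mat_def)
    then show "(C * R) $$ (i, j) = 0\<^sub>m n n $$ (i, j)"
      using ij carr by (auto simp: scalar_prod_def intro!: sum.neutral)
  qed (use carr in auto)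
  have TR: "T * R = R"
    unfolding T_def using carr CR
    by (simp add: add_mult_distrib_mat[of _ n n _ _ n] assoc_mult_mat[of V n n C n R n])
  \<comment> \<open>\<open>D * V\<close> is the identity except for a zero in the corner: its
    subdiagonal entries contain differences of equal values, as \<open>E\<close> avoids
    \<open>n - 2\<close>. The zero corner is harmless because the last row of \<open>C\<close> is
    zero.\<close>
  have "D * V * C = C"
  proof (rule eq_matI)
    fix i j assume "i < dim_row C" "j < dim_col C"
    then have ij: "i < n" "j < n" using carr by auto
    have DV: "D * V = bidiag_mat n E s (\<lambda>i. \<xi> i ^ k * inverse (\<xi> i ^ k))"
      unfolding D_def V_def by (rule bidiag_mat_mult[OF E])
    have "(D * V) $$ (i, l) * C $$ (l, j) = (if l = i then C $$ (i, j) else 0)" if "l < n" for l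
      unfolding DV using that ij En[of l] nz
      by (auto simp: C_def last_col_mat_def bidiag_mat_def)
    then have "(\<Sum>l<n. (D * V) $$ (i, l) * C $$ (l, j)) = C $$ (i, j)"
      using ij by simp
    moreover have "(D * V * C) $$ (i, j) = (\<Sum>l<n. (D * V) $$ (i, l) * C $$ (l, j))"
      by (rule index_mult_mat_sum) (use ij carr in auto)
    ultimately show "(D * V * C) $$ (i, j) = C $$ (i, j)" by simp
  qed (use carr in auto)
  then have DT: "D * T = D + C"
    unfolding T_def using carr
    by (simp add: mult_add_distrib_mat[of _ n n _ n] assoc_mult_mat[of D n n V n C n])
  have "R ^\<^sub>m k = D" unfolding R_def D_def by (rule bidiag_mat_pow[OF E])
  then have "(R * T) ^\<^sub>m k = D + C"
    using pow_mat_mult_absorb[OF carr(1) T TR k] DT by simp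
  moreover have "R * T \<in> carrier_mat n n" using carr T by simp
  ultimately show ?thesis unfolding D_def C_def by blast
qed

text \<open>The subdiagonal one in column \<open>j\<close> is assigned by the parity of
  \<open>n - j\<close>. Counting from the end puts \<open>n - 2\<close> into \<open>EC\<close>, so
  the last row of the first summand can be zero, while the second supplies the corner
  \<open>w (n - 1)\<close>.\<close>

lemma hessenberg_eq_sum_powers:
  fixes x :: "'a :: field" and w :: "nat \<Rightarrow> 'a"
  assumes n: "n \<ge> 2" and k: "k \<ge> 1"
    and x: "x \<noteq> 0" "x = \<xi> ^ k" and w: "\<And>i. w i \<noteq> 0" "\<And>i. w i \<noteq> x" "\<And>i. w i = \<omega> i ^ k"
    and c: "c (n - 1) = w (n - 1)"
  shows "\<exists>B \<in> carrier_mat n n. \<exists>C \<in> carrier_mat n n.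
    hessenberg_mat n (\<lambda>i. x + w i) c = B ^\<^sub>m k + C ^\<^sub>m k"
proof -
  \<comment> \<open>In both summands a block of size two starting at \<open>j\<close> has
    \<open>x\<close> at \<open>j\<close> and \<open>w (Suc j)\<close> at \<open>Suc j\<close> on its
    diagonal, so this factor makes its subdiagonal entry one.\<close>
  define s where "s = (\<lambda>j. inverse (x - w (Suc j)))"
  define EB where "EB = {j. Suc j < n \<and> odd (n - j)}"
  define EC where "EC = {j. Suc j < n \<and> even (n - j)}"
  \<comment> \<open>\<open>\<beta>\<close> and \<open>\<gamma>\<close> swap the roots of
    \<open>x\<close> and \<open>w j\<close> by parity, so their powers add up to
    \<open>x + w j\<close>. In the last place \<open>\<beta>\<close> is zero instead and
    \<open>\<gamma>\<close> gives \<open>w (n - 1)\<close>.\<close>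
  define \<beta> where "\<beta> = (\<lambda>j. if Suc j = n then 0 else if even (n - j) then \<omega> j else \<xi>)"
  define \<gamma> where "\<gamma> = (\<lambda>j. if even (n - j) then \<xi> else \<omega> j)"
  have par: "even (n - Suc j) \<longleftrightarrow> odd (n - j)" if "j < n" for j
    using that by (simp add: Suc_diff_Suc[OF that, symmetric])
  have EB: "Suc j \<notin> EB" "Suc (Suc j) < n" if "j \<in> EB" for j
  proof -
    have j: "Suc j < n" "odd (n - j)" using that unfolding EB_def by auto
    then have "even (n - Suc j)" using par[of j] by simp
    then show "Suc j \<notin> EB" unfolding EB_def by simp
    have "n - j \<noteq> 2" using j(2) by (metis even_numeral)
    then show "Suc (Suc j) < n" using j(1) by linarith
  qed
  have EC: "Suc j \<notin> EC" if "j \<in> EC" for j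
  proof -
    have "Suc j < n" "even (n - j)" using that unfolding EC_def by blast+
    then have "odd (n - Suc j)" using par[of j] by linarith
    then show ?thesis unfolding EC_def by blast
  qed
  have "\<exists>B \<in> carrier_mat n n. B ^\<^sub>m k = bidiag_mat n EB s (\<lambda>i. \<beta> i ^ k) + last_col_mat n c"
  proof (rule bidiag_plus_last_col_power[OF EB])
    have "\<xi> \<noteq> 0" "\<And>i. \<omega> i \<noteq> 0" using x w(1,3) k by (metis zero_power not_less_eq_eq One_nat_def Suc_le_eq)+
    then show "\<beta> i \<noteq> 0" if "Suc i < n" for i using that unfolding \<beta>_def by simp
    show "\<beta> (n - 1) = 0" using n unfolding \<beta>_def by simp
  qed (use k in auto)
  then obtain B where B: "B \<in> carrier_mat n n"
    "B ^\<^sub>m k = bidiag_mat n EB s (\<lambda>i. \<beta> i ^ k) + last_col_mat n c" by blast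
  define C where "C = bidiag_mat n EC s \<gamma>"
  have C: "C \<in> carrier_mat n n" "C ^\<^sub>m k = bidiag_mat n EC s (\<lambda>i. \<gamma> i ^ k)"
    unfolding C_def using bidiag_mat_pow[OF EC] by auto
  have \<beta>k: "\<beta> j ^ k = (if Suc j = n then 0 else if even (n - j) then w j else x)" for j
    using k x w(3) unfolding \<beta>_def by (simp add: zero_power)
  have \<gamma>k: "\<gamma> j ^ k = (if even (n - j) then x else w j)" for j
    using x w(3) unfolding \<gamma>_def by simp
  have xw: "(x - w i) * inverse (x - w i) = 1" for i
    using w(2)[of i] by simp
  have "hessenberg_mat n (\<lambda>i. x + w i) c = B ^\<^sub>m k + C ^\<^sub>m k"
  proof (rule eq_matI)
    fix i j assume "i < dim_row (B ^\<^sub>m k + C ^\<^sub>m k)" "j < dim_col (B ^\<^sub>m k + C ^\<^sub>m k)"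
    then have ij: "i < n" "j < n" unfolding B C by (auto simp: bidiag_mat_def)
    consider (1) "Suc j = n" "i = j" | (2) "Suc j = n" "i < j" | (3) "Suc j < n" "i = j" |
      (4) "Suc j < n" "i = Suc j" | (5) "Suc j < n" "i \<noteq> j" "i \<noteq> Suc j"
      using ij by linarith
    then show "hessenberg_mat n (\<lambda>i. x + w i) c $$ (i, j) = (B ^\<^sub>m k + C ^\<^sub>m k) $$ (i, j)"
    proof cases
      case 1
      then have "n - j = 1" "n - 1 = j" by auto
      then show ?thesis unfolding B C using 1 ij c
        by (simp add: hessenberg_mat_def bidiag_mat_def last_col_mat_def \<beta>k \<gamma>k del: even_diff_nat)
    next
      case 4
      then show ?thesis unfolding B C using ij par[of j] xw[of i] EB(2)[of j]
        by (auto simp: hessenberg_mat_def bidiag_mat_def last_col_mat_def \<beta>k \<gamma>k EB_def EC_def s_def)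
    qed (use ij in \<open>auto simp: B C hessenberg_mat_def bidiag_mat_def last_col_mat_def \<beta>k \<gamma>k\<close>)
  qed (auto simp: B C hessenberg_mat_def bidiag_mat_def)
  then show ?thesis using B(1) C(1) by blast
qed

section \<open>Transfer to cyclic matrices by similarity\<close>

lemma sum_powers_similar:
  fixes A :: "'a :: comm_ring_1 mat"
  assumes A: "A \<in> carrier_mat n n" and wit: "similar_mat_wit A H P Q"
    and B: "B \<in> carrier_mat n n" and C: "C \<in> carrier_mat n n" and H: "H = B ^\<^sub>m k + C ^\<^sub>m k"
  shows "\<exists>B \<in> carrier_mat n n. \<exists>C \<in> carrier_mat n n. A = B ^\<^sub>m k + C ^\<^sub>m k"
proof -
  have c: "P \<in> carrier_mat n n" "Q \<in> carrier_mat n n"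
    and PQ: "P * Q = 1\<^sub>m n" "Q * P = 1\<^sub>m n" and AP: "A = P * H * Q"
    using wit A unfolding similar_mat_wit_def Let_def by auto
  have pow: "(P * X * Q) ^\<^sub>m k = P * X ^\<^sub>m k * Q" if "X \<in> carrier_mat n n" for X
    by (rule similar_mat_wit_pow_id)
      (use that c PQ in \<open>auto simp: similar_mat_wit_def Let_def\<close>)
  have "A = P * B ^\<^sub>m k * Q + P * C ^\<^sub>m k * Q"
    unfolding AP H using B C c
    by (simp add: mult_add_distrib_mat[of _ n n _ n] add_mult_distrib_mat[of _ n n _ _ n])
  then have "A = (P * B * Q) ^\<^sub>m k + (P * C * Q) ^\<^sub>m k" using pow B C by simp
  moreover have "P * B * Q \<in> carrier_mat n n" "P * C * Q \<in> carrier_mat n n" using B C c by auto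
  ultimately show ?thesis by blast
qed

text \<open>All diagonal entries but the last are prescribed as \<open>x + w i\<close>. The trace
  hypothesis, with one \<open>x\<close> fewer than there are \<open>w i\<close>, then forces the
  corner to be \<open>w (n - 1)\<close>.\<close>

lemma cyclic_mat_eq_sum_powers:
  fixes A :: "'a :: field mat"
  assumes A: "A \<in> carrier_mat n n" and cyc: "cyclic_mat A" and n: "n \<ge> 2" and k: "k \<ge> 1"
    and x: "x \<noteq> 0" "x = \<xi> ^ k" and w: "\<And>i. w i \<noteq> 0" "\<And>i. w i \<noteq> x" "\<And>i. w i = \<omega> i ^ k"
    and tr: "mat_trace A = of_nat (n - 1) * x + (\<Sum>i<n. w i)"
  shows "\<exists>B \<in> carrier_mat n n. \<exists>C \<in> carrier_mat n n. A = B ^\<^sub>m k + C ^\<^sub>m k"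
proof -
  have n0: "n > 0" using n by simp
  obtain P Q c where wit: "similar_mat_wit A (hessenberg_mat n (\<lambda>i. x + w i) c) P Q"
    using cyclic_mat_similar_hessenberg[OF A cyc n0] by blast
  have "mat_trace A = (\<Sum>i<n-1. x + w i) + c (n - 1)"
    using mat_trace_similar[OF A wit] mat_trace_hessenberg[OF n0] by simp
  moreover have "(\<Sum>i<n. w i) = (\<Sum>i<n-1. w i) + w (n - 1)"
    using n by (cases n) auto
  ultimately have "c (n - 1) = w (n - 1)" using tr by (simp add: sum.distrib algebra_simps)
  then show ?thesis
    using hessenberg_eq_sum_powers[OF n k x, of w \<omega> c] w sum_powers_similar[OF A wit] by blast
qed

section \<open>Finite fields\<close>

lemma card_power_eq_le:
  fixes c :: "'a :: idom"
  assumes "m > 0"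
  shows "card {x :: 'a. x ^ m = c} \<le> m"
proof -
  let ?P = "monom 1 m - [:c:] :: 'a poly"
  have lc: "coeff ?P m = 1" using assms by (cases m) (auto simp: coeff_pCons)
  then have "?P \<noteq> 0" by (metis coeff_0 zero_neq_one)
  then have "card {x. poly ?P x = 0} \<le> degree ?P" by (rule card_poly_roots_bound)
  also have "degree ?P \<le> m" by (rule degree_diff_le) (auto simp: degree_monom_le)
  finally show ?thesis by (simp add: poly_monom)
qed

lemma finite_field_power_card_minus_one:
  fixes x :: "'a :: finite_field"
  assumes "x \<noteq> 0"
  shows "x ^ (CARD('a) - 1) = 1"
proof -
  have "CARD('a) = Suc (CARD('a) - 1)" using finite_UNIV_card_ge_0[where ?'a = 'a] by simp
  then have "x * x ^ (CARD('a) - 1) = x"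
    using finite_field_power_card_eq_same[of x] by (metis power_Suc)
  then show ?thesis using assms by simp
qed

text \<open>Counting replaces cyclicity of the multiplicative group: the map to \<open>e\<close>-th
  powers has fibres of size at most \<open>e\<close>, so its image has at least \<open>m\<close>
  elements. The image consists of \<open>m\<close>-th roots of unity, of which there are at most
  \<open>m\<close>.\<close>

lemma finite_field_roots_of_unity:
  assumes me: "m * e = CARD('a :: finite_field) - 1"
  shows "{x :: 'a. x ^ m = 1} = {x ^ e | x. x \<noteq> 0}" and "card {x :: 'a. x ^ m = 1} = m"
proof -
  have "card {0, 1 :: 'a} \<le> CARD('a)" by (rule card_mono) auto
  then have "CARD('a) - 1 > 0" by simp
  then have "m * e > 0" using me by simp
  then have pos: "m > 0" "e > 0" by simp_all
  define G where "G = UNIV - {0 :: 'a}"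
  let ?f = "\<lambda>x :: 'a. x ^ e"
  have cG: "card G = m * e" unfolding G_def me by (simp add: card_Diff_singleton)
  have "(\<Union>y \<in> ?f ` G. {x \<in> G. x ^ e = y}) = G" by auto
  then have "card G \<le> (\<Sum>y \<in> ?f ` G. card {x \<in> G. x ^ e = y})"
    using card_UN_le[of "?f ` G" "\<lambda>y. {x \<in> G. x ^ e = y}"] by simp
  also have "\<dots> \<le> (\<Sum>y \<in> ?f ` G. e)"
  proof (rule sum_mono)
    fix y
    have "card {x \<in> G. x ^ e = y} \<le> card {x. x ^ e = y}" by (rule card_mono) auto
    then show "card {x \<in> G. x ^ e = y} \<le> e" using card_power_eq_le[OF pos(2), of y] by linarith
  qed
  finally have "m * e \<le> card (?f ` G) * e" using cG by simp
  then have 1: "m \<le> card (?f ` G)" using pos by simp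
  have sub: "?f ` G \<subseteq> {x. x ^ m = 1}"
    using finite_field_power_card_minus_one[where ?'a = 'a]
    by (auto simp: G_def me power_mult[symmetric] mult.commute[of e m])
  have 2: "card {x :: 'a. x ^ m = 1} \<le> m" by (rule card_power_eq_le[OF pos(1)])
  have "?f ` G = {x. x ^ m = 1}" by (rule card_seteq) (use sub 1 2 in auto)
  then show "{x :: 'a. x ^ m = 1} = {x ^ e | x. x \<noteq> 0}" "card {x :: 'a. x ^ m = 1} = m"
    using 1 2 by (auto simp: G_def)
qed

lemma power_gcd_eq_1:
  fixes x :: "'a :: field"
  assumes "x ^ a = 1" "x ^ b = 1" "a > 0"
  shows "x ^ gcd a b = 1"
proof -
  obtain r s where "a * r = b * s + gcd a b" using bezout_nat[of a b] assms(3) by auto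
  then have "x ^ (a * r) = x ^ (b * s) * x ^ gcd a b" by (simp add: power_add)
  then show ?thesis using assms by (simp add: power_mult)
qed

section \<open>The prime subfield\<close>

lemma prime_subfield_eq_of_nat:
  "prime_subfield = (of_nat ` {..<CHAR('a)} :: 'a :: finite_field set)"
proof
  show "prime_subfield \<subseteq> (of_nat ` {..<CHAR('a)} :: 'a set)"
  proof
    fix x :: 'a assume "x \<in> prime_subfield"
    then obtain i where i: "x = of_int i" unfolding prime_subfield_def by blast
    define r where "r = nat (i mod int CHAR('a))"
    have pos: "CHAR('a) > 0" by simp
    have r: "int r = i mod int CHAR('a)" unfolding r_def using pos by simp
    have "of_int i = (of_int (int CHAR('a) * (i div int CHAR('a)) + i mod int CHAR('a)) :: 'a)" by simp
    also have "\<dots> = of_int (i mod int CHAR('a))"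
      by (simp only: of_int_add of_int_mult of_int_of_nat_eq of_nat_CHAR) simp
    also have "\<dots> = of_nat r" using r by (metis of_int_of_nat_eq)
    finally have "x = of_nat r" using i by simp
    moreover have "r < CHAR('a)" using r pos by (metis of_nat_0_less_iff of_nat_less_iff pos_mod_bound)
    ultimately show "x \<in> of_nat ` {..<CHAR('a)}" by blast
  qed
  show "(of_nat ` {..<CHAR('a)} :: 'a set) \<subseteq> prime_subfield"
    unfolding prime_subfield_def by (metis image_subsetI of_int_of_nat_eq rangeI)
qed

text \<open>By the Frobenius map, the nonzero elements of the prime subfield are roots of this
  equation, and they already reach its maximal number of roots. Membership thus becomes a condition
  on exponents.\<close>

lemma prime_subfield_nonzero_eq:
  "prime_subfield - {0} = {x :: 'a :: finite_field. x ^ (CHAR('a) - 1) = 1}"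
proof (rule card_seteq)
  let ?p = "CHAR('a)"
  have prime: "prime ?p" by simp
  have p1: "?p - 1 > 0" using prime_gt_1_nat[OF prime] by simp
  show "prime_subfield - {0} \<subseteq> {x :: 'a. x ^ (?p - 1) = 1}"
  proof
    fix x :: 'a assume x: "x \<in> prime_subfield - {0}"
    then obtain r where r: "x = of_nat r" unfolding prime_subfield_eq_of_nat by blast
    have "(of_nat r :: 'a) ^ ?p = of_nat r"
      by (induction r) (auto simp: zero_power freshmans_dream[OF prime refl])
    moreover have "?p = Suc (?p - 1)" using p1 by simp
    ultimately have "x * x ^ (?p - 1) = x" unfolding r by (metis power_Suc)
    then show "x \<in> {x. x ^ (?p - 1) = 1}" using x by simp
  qed
  have "inj_on (of_nat :: nat \<Rightarrow> 'a) {..<?p}"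
    by (rule inj_onI) (simp add: of_nat_eq_iff_cong_CHAR cong_def)
  then have "card (prime_subfield :: 'a set) = ?p"
    unfolding prime_subfield_eq_of_nat by (simp add: card_image)
  moreover have "(0 :: 'a) \<in> prime_subfield" unfolding prime_subfield_def by (metis of_int_0 rangeI)
  ultimately have "card (prime_subfield - {0 :: 'a}) = ?p - 1" by (simp add: card_Diff_singleton)
  then show "card {x :: 'a. x ^ (?p - 1) = 1} \<le> card (prime_subfield - {0 :: 'a})"
    using card_power_eq_le[OF p1, of "1 :: 'a"] by simp
qed simp

lemma prime_subfield_diff:
  "x \<in> prime_subfield \<Longrightarrow> y \<in> prime_subfield \<Longrightarrow> x - y \<in> prime_subfield"
  unfolding prime_subfield_def by (metis (mono_tags, lifting) imageE of_int_diff rangeI)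

lemma prime_subfield_mult:
  "x \<in> prime_subfield \<Longrightarrow> y \<in> prime_subfield \<Longrightarrow> x * y \<in> prime_subfield"
  unfolding prime_subfield_def by (metis (mono_tags, lifting) imageE of_int_mult rangeI)

lemma prime_subfield_of_nat: "of_nat m \<in> prime_subfield"
  unfolding prime_subfield_def by (metis of_int_of_nat_eq rangeI)

lemma prime_subfield_divide:
  fixes x y :: "'a :: finite_field"
  assumes "x \<in> prime_subfield" "y \<in> prime_subfield"
  shows "x / y \<in> prime_subfield"
proof (cases "x = 0 \<or> y = 0")
  case True
  then show ?thesis using prime_subfield_of_nat[of 0] by auto
next
  case False
  then have "x \<in> prime_subfield - {0}" "y \<in> prime_subfield - {0}" using assms by auto
  then have "x / y \<in> prime_subfield - {0}"
    unfolding prime_subfield_nonzero_eq by (simp add: power_divide)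
  then show ?thesis by blast
qed

lemma CHAR_eq_of_CARD_eq_power:
  assumes "prime p" "CARD('a :: finite_field) = p ^ l"
  shows "CHAR('a) = p"
proof -
  \<comment> \<open>Translation by one permutes the field, so comparing the two sums shows that the
    field's cardinality is zero in the field.\<close>
  have "(\<Sum>x \<in> UNIV. x + 1) = (\<Sum>x \<in> UNIV. x :: 'a)"
    by (rule sum.reindex_bij_witness[of _ "\<lambda>x. x - 1" "\<lambda>x. x + 1"]) auto
  then have "of_nat CARD('a) = (0 :: 'a)" by (simp add: sum.distrib)
  then have "CHAR('a) dvd p ^ l" unfolding assms(2) of_nat_eq_0_iff_char_dvd .
  then have "CHAR('a) dvd p" using prime_dvd_power_nat[of "CHAR('a)"] by simp
  then show ?thesis using assms(1) by (metis CHAR_prime primes_dvd_imp_eq)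
qed

text \<open>Both sets are groups of roots of unity, with exponents \<open>CHAR('a) - 1\<close> and
  \<open>(CARD('a) - 1) div d\<close>. They meet in the roots of unity for the gcd of the exponents,
  which divides \<open>CARD('a) - 1\<close> and is therefore their number.\<close>

lemma card_prime_subfield_powers:
  assumes "d dvd CARD('a :: finite_field) - 1"
  shows "card ((prime_subfield - {0}) \<inter> {x ^ d | x :: 'a. True}) =
    gcd ((CARD('a) - 1) div d) (CHAR('a) - 1)"
proof -
  let ?m = "(CARD('a) - 1) div d" let ?g = "gcd ?m (CHAR('a) - 1)"
  have md: "?m * d = CARD('a) - 1" using assms by simp
  have "card {0, 1 :: 'a} \<le> CARD('a)" by (rule card_mono) auto
  then have "CARD('a) - 1 > 0" by simp
  then have m: "?m > 0" using md by (metis mult_0 neq0_conv)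
  have "(prime_subfield - {0}) \<inter> {x ^ d | x :: 'a. True} =
      {x. x ^ (CHAR('a) - 1) = 1} \<inter> {x ^ d | x :: 'a. x \<noteq> 0}"
    unfolding prime_subfield_nonzero_eq[symmetric] using m md
    by (cases "d = 0") (use \<open>CARD('a) - 1 > 0\<close> in \<open>auto simp: zero_power\<close>)
  also have "\<dots> = {x. x ^ (CHAR('a) - 1) = 1} \<inter> {x. x ^ ?m = 1}"
    using finite_field_roots_of_unity(1)[OF md] by simp
  also have "\<dots> = {x. x ^ ?g = 1}"
  proof (intro equalityI subsetI)
    fix x :: 'a assume "x \<in> {x. x ^ ?g = 1}"
    then have "x ^ ?g = 1" by simp
    then have "x ^ (?g * r) = 1" for r by (simp add: power_mult)
    then have "x ^ (CHAR('a) - 1) = 1" "x ^ ?m = 1"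
      by (metis dvd_mult_div_cancel gcd_dvd2, metis dvd_mult_div_cancel gcd_dvd1)
    then show "x \<in> {x. x ^ (CHAR('a) - 1) = 1} \<inter> {x. x ^ ?m = 1}" by blast
  qed (use m in \<open>auto intro: power_gcd_eq_1\<close>)
  finally have eq: "(prime_subfield - {0}) \<inter> {x ^ d | x :: 'a. True} = {x. x ^ ?g = 1}" .
  have "?g dvd CARD('a) - 1" using md by (metis dvd_mult2 gcd_dvd1)
  then have "?g * ((CARD('a) - 1) div ?g) = CARD('a) - 1" by simp
  then show ?thesis unfolding eq by (rule finite_field_roots_of_unity(2))
qed

text \<open>By Bezout the gcd is congruent to \<open>k * r\<close> modulo
  \<open>CARD('a) - 1\<close>, an exponent that kills every nonzero \<open>u\<close>; so
  \<open>u ^ r\<close> is the required root.\<close>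

lemma power_gcd_card_is_power:
  fixes u :: "'a :: finite_field"
  assumes "k > 0"
  shows "\<exists>v. u ^ gcd k (CARD('a) - 1) = v ^ k"
proof (cases "u = 0")
  case True
  then have "u ^ gcd k (CARD('a) - 1) = 0 ^ k" using assms by (simp add: zero_power)
  then show ?thesis by blast
next
  case False
  have "k \<noteq> 0" using assms by simp
  then obtain r s where "k * r = (CARD('a) - 1) * s + gcd k (CARD('a) - 1)"
    using bezout_nat[of k] by blast
  then have "u ^ (k * r) = (u ^ (CARD('a) - 1)) ^ s * u ^ gcd k (CARD('a) - 1)"
    by (simp add: power_add power_mult)
  also have "\<dots> = u ^ gcd k (CARD('a) - 1)"
    unfolding finite_field_power_card_minus_one[OF False] by simp
  finally have "u ^ gcd k (CARD('a) - 1) = (u ^ r) ^ k"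
    by (simp add: power_mult[symmetric] mult.commute)
  then show ?thesis by blast
qed

text \<open>With \<open>j\<close> copies of \<open>z\<close> the sum is
  \<open>n * y + j * (z - y)\<close>. The equation for \<open>j\<close> is solvable in the prime
  subfield, and a representative below \<open>CHAR('a)\<close> leaves room among the
  \<open>n\<close> summands.\<close>

lemma exists_two_valued_sum:
  fixes y z t :: "'a :: finite_field"
  assumes "y \<in> prime_subfield" "z \<in> prime_subfield" "t \<in> prime_subfield" "y \<noteq> z"
    and n: "CHAR('a) \<le> n"
  obtains j where "t = (\<Sum>i<n. if i < j then z else y)"
proof -
  have "(t - of_nat n * y) / (z - y) \<in> prime_subfield"
    using assms by (intro prime_subfield_divide prime_subfield_diff prime_subfield_mult prime_subfield_of_nat)
  then obtain j where j: "(t - of_nat n * y) / (z - y) = of_nat j" "j < CHAR('a)"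
    unfolding prime_subfield_eq_of_nat by auto
  have "(\<Sum>i<n. if i < j then z else y) = (\<Sum>i<n. y + (if i < j then z - y else 0))"
    by (intro sum.cong) auto
  also have "\<dots> = of_nat n * y + (\<Sum>i<n. if i < j then z - y else 0)"
    by (simp add: sum.distrib)
  also have "(\<Sum>i<n. if i < j then z - y else 0) = (\<Sum>i<j. z - y)"
    using j(2) n by (intro sum.mono_neutral_cong_right) auto
  also have "of_nat n * y + (\<Sum>i<j. z - y) = t"
    using j(1) assms(4) by (simp add: divide_eq_eq diff_eq_eq add.commute)
  finally show ?thesis using that by metis
qed

section \<open>Sums of two \<open>k\<close>-th powers of matrices over a finite field\<close>

theorem theorem1p13:
  fixes p l q n k d :: nat
  assumes "prime p" and "q = p ^ l" and "CARD('a :: finite_field) = q"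
    and "n \<ge> 2" and "k \<ge> 1" and "d = gcd k (q - 1)"
  shows "(gcd ((q - 1) div d) (p - 1) \<ge> 3 \<longleftrightarrow>
            card ((prime_subfield - {0}) \<inter> {x ^ d | x :: 'a. True}) \<ge> 3) \<and>
         (gcd ((q - 1) div d) (p - 1) \<ge> 3 \<and> n > p - 1 \<longrightarrow>
            (\<forall>A :: 'a mat. A \<in> carrier_mat n n \<and> cyclic_mat A \<and> mat_trace A \<in> prime_subfield \<longrightarrow>
               (\<exists>B \<in> carrier_mat n n. \<exists>C \<in> carrier_mat n n. A = B ^\<^sub>m k + C ^\<^sub>m k)))"
proof (intro conjI impI allI)
  let ?S = "(prime_subfield - {0}) \<inter> {x ^ d | x :: 'a. True}"
  have char: "CHAR('a) = p" using CHAR_eq_of_CARD_eq_power assms(1-3) by metis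
  have d: "d = gcd k (CARD('a) - 1)" using assms by simp
  have cardS: "card ?S = gcd ((q - 1) div d) (p - 1)"
    using card_prime_subfield_powers[where ?'a = 'a, of d] assms(3) char d by simp
  then show "(gcd ((q - 1) div d) (p - 1) \<ge> 3) = (card ?S \<ge> 3)" by simp
  fix A :: "'a mat"
  assume g: "gcd ((q - 1) div d) (p - 1) \<ge> 3 \<and> n > p - 1"
    and A: "A \<in> carrier_mat n n \<and> cyclic_mat A \<and> mat_trace A \<in> prime_subfield"
  obtain T where T: "T \<subseteq> ?S" "card T = 3"
    using obtain_subset_with_card_n[of 3 ?S] g cardS by auto
  then obtain x y z where xyz: "T = {x, y, z}" "x \<noteq> y" "x \<noteq> z" "y \<noteq> z"
    unfolding card_3_iff by metis
  \<comment> \<open>Elements of \<open>?S\<close> are only \<open>d\<close>-th powers by definition;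
    as \<open>d\<close> is the gcd of \<open>k\<close> and \<open>q - 1\<close>, they are
    \<open>k\<close>-th powers too.\<close>
  have pw: "\<exists>v. u = v ^ k" if "u \<in> ?S" for u
    using that power_gcd_card_is_power[where ?'a = 'a, of k] assms(5) d by force
  have mem: "x \<in> ?S" "y \<in> ?S" "z \<in> ?S" using T(1) xyz(1) by auto
  then obtain \<xi> \<eta> \<zeta> where roots: "x = \<xi> ^ k" "y = \<eta> ^ k" "z = \<zeta> ^ k"
    using pw by meson
  \<comment> \<open>\<open>x\<close> enters all diagonal entries but the last. What remains of the
    trace has to be a sum of \<open>n\<close> values from \<open>y\<close> and
    \<open>z\<close>.\<close>
  have "mat_trace A - of_nat (n - 1) * x \<in> prime_subfield"
    using A mem by (intro prime_subfield_diff prime_subfield_mult prime_subfield_of_nat) auto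
  moreover have "CHAR('a) \<le> n" using g char by linarith
  ultimately obtain j where j: "mat_trace A - of_nat (n - 1) * x = (\<Sum>i<n. if i < j then z else y)"
    using mem xyz(4) exists_two_valued_sum[of y z] by (metis DiffD1 IntD1)
  show "\<exists>B \<in> carrier_mat n n. \<exists>C \<in> carrier_mat n n. A = B ^\<^sub>m k + C ^\<^sub>m k"
  proof (rule cyclic_mat_eq_sum_powers)
    show "A \<in> carrier_mat n n" "cyclic_mat A" using A by auto
    show "x = \<xi> ^ k" by (rule roots)
    show "(if i < j then z else y) = (if i < j then \<zeta> else \<eta>) ^ k" for i using roots by simp
    show "mat_trace A = of_nat (n - 1) * x + (\<Sum>i<n. if i < j then z else y)"
      using j by (simp add: algebra_simps)
  qed (use assms mem xyz in auto)
qed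

end
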